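(* Let $G=(V,E)$ be a homogeneous chordal graph with $V=\{1,\dots,n\}$ and let $\mathcal{F}$ be a face of $\mathcal{S}_+(G)$. Then $\mathcal{F}$ is projectionally exposed and there exists an automorphism $Q$ of $\mathcal{S}_+(G)$ that maps $\mathcal{F}$ to $\mathcal{F}(H)$, where $H$ is an induced subgraph of $G$. Additionally, if the vertices of $G$ are in a trivially perfect elimination ordering, the following hold. (i) $Q$ can be assumed to be of the form $Q=Q_l$ for some $l\in\mathcal{L}_{++}(G)$. In particular, $Q_l(y)=lyl^*$ holds for $y\in\mathcal{S}_+(G)$. (ii) Suppose that $x\in\operatorname{ri}\mathcal{F}$ and $x=tt^*$ holds for a proper matrix $t\in\mathcal{L}_+(G)$. Then, letting $I=\{i\mid t_{ii}=0\}$, $H$ is the subgraph obtained by removing the vertices belonging to $I$. Furthermore, $l$ in item (i) can be taken to be any $l\in\mathcal{L}_{++}(G)$ satisfying $lt=e_I$, where $e_I$ is the diagonal matrix that has $1$ in its $(i,i)$ component if $i\notin I$ and zero elsewhere.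
   Context: $G=(V,E)$ is a finite simple undirected graph with $V=\{1,\dots,n\}$. It is homogeneous chordal if it is chordal and has no induced subgraph isomorphic to a path on $4$ vertices. The vertices are in a trivially perfect elimination ordering if (o1) $\{i,j\},\{i,k\}\in E$ and $i<j<k$ imply $\{j,k\}\in E$, and (o2) $\{i,j\},\{j,k\}\in E$ and $i<j<k$ imply $\{i,k\}\in E$. $\mathcal{S}^n_+$ is the cone of real symmetric positive semidefinite $n\times n$ matrices, $\mathcal{S}_+(G)=\{x\in\mathcal{S}^n_+: x_{ij}=0\text{ for all }i\ne j\text{ with }\{i,j\}\notin E\}$, and $\mathcal{S}(G)=\operatorname{span}\mathcal{S}_+(G)$, which is the ambient space. $a^*$ denotes the transpose of $a$. For an induced subgraph $H=(\hat V,\hat E)$ of $G$ (possibly empty or all of $G$), $\mathcal{F}(H)=\{x\in\mathcal{S}_+(G): x_{ii}=0\ \forall i\notin\hat V\}$. $\mathcal{L}_+(G)$ (resp. $\mathcal{L}_{++}(G)$) is the set of real lower triangular $n\times n$ matrices $l$ with nonnegative (resp. positive) diagonal and with $l_{ij}=0$ whenever $i\ne j$ and $\{i,j\}\notin E$. A matrix $t\in\mathcal{L}_+(G)$ is proper if $t_{ii}=0$ implies that the $i$-th column of $t$ is zero. $\pi_G$ is the map that sets to zero all $(i,j)$ entries of an $n\times n$ matrix with $i\ne j$, $\{i,j\}\notin E$, and $a\star b=\pi_G(ab)$. For $l\in\mathcal{L}_{++}(G)$, $Q_l:\mathcal{S}(G)\to\mathcal{S}(G)$ is the linear map $Q_l(b)=\tfrac12(c+c^*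 )$ with $c=l\star(b\star l^* )+l\star(l\star b)-(l\star l)\star b$. A face of a convex cone $\mathcal{K}$ is a nonempty convex cone $\mathcal{F}\subseteq\mathcal{K}$ such that $x,y\in\mathcal{K}$, $x+y\in\mathcal{F}$ imply $x,y\in\mathcal{F}$. $\mathcal{F}$ is projectionally exposed if there is a linear map $\mathcal{P}$ of the ambient space to itself with $\mathcal{P}^2=\mathcal{P}$ and $\mathcal{P}(\mathcal{K})=\mathcal{F}$. An automorphism of $\mathcal{K}$ is a linear bijection of the ambient space mapping $\mathcal{K}$ onto itself. $\operatorname{ri}$ is the relative interior. *)

theory Defs
  imports "HOL-Analysis.Analysis"
begin

text \<open>
  A graph on the vertex set \<open>UNIV :: 'n set\<close> is given by its set of edges, a set of
  two-element sets.  The vertex set \<open>{1, ..., n}\<close> is rendered by a finite linearly ordered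
  index type \<open>'n\<close>, which is order-isomorphic to \<open>{1, ..., CARD('n)}\<close>.
\<close>

type_synonym 'n sqmat = "real^'n^'n"

definition simple_graph :: "'n set set \<Rightarrow> bool" where
  "simple_graph E \<longleftrightarrow> (\<forall>e\<in>E. card e = 2)"

definition is_cycle :: "'n set set \<Rightarrow> 'n list \<Rightarrow> bool" where
  "is_cycle E vs \<longleftrightarrow> length vs \<ge> 3 \<and> distinct vs \<and>
     (\<forall>i<length vs. {vs ! i, vs ! (Suc i mod length vs)} \<in> E)"

definition has_chord :: "'n set set \<Rightarrow> 'n list \<Rightarrow> bool" where
  "has_chord E vs \<longleftrightarrow> (\<exists>i<length vs. \<exists>j<length vs. i \<noteq> j \<and>
     j \<noteq> Suc i mod length vs \<and> i \<noteq> Suc j mod length vs \<and> {vs ! i, vs ! j} \<in> E)"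

definition chordal :: "'n set set \<Rightarrow> bool" where
  "chordal E \<longleftrightarrow> (\<forall>vs. is_cycle E vs \<and> length vs \<ge> 4 \<longrightarrow> has_chord E vs)"

definition has_induced_P4 :: "'n set set \<Rightarrow> bool" where
  "has_induced_P4 E \<longleftrightarrow> (\<exists>a b c d. distinct [a, b, c, d] \<and>
     {a, b} \<in> E \<and> {b, c} \<in> E \<and> {c, d} \<in> E \<and>
     {a, c} \<notin> E \<and> {a, d} \<notin> E \<and> {b, d} \<notin> E)"

definition homogeneous_chordal :: "'n set set \<Rightarrow> bool" where
  "homogeneous_chordal E \<longleftrightarrow> simple_graph E \<and> chordal E \<and> \<not> has_induced_P4 E"

definition trivially_perfect_elim_order :: "'n::linorder set set \<Rightarrow> bool" where
  "trivially_perfect_elim_order E \<longleftrightarrow>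
     (\<forall>i j k. {i, j} \<in> E \<and> {i, k} \<in> E \<and> i < j \<and> j < k \<longrightarrow> {j, k} \<in> E) \<and>
     (\<forall>i j k. {i, j} \<in> E \<and> {j, k} \<in> E \<and> i < j \<and> j < k \<longrightarrow> {i, k} \<in> E)"

definition psd :: "'n::finite sqmat \<Rightarrow> bool" where
  "psd x \<longleftrightarrow> transpose x = x \<and> (\<forall>v. 0 \<le> v \<bullet> (x *v v))"

definition S_plus :: "'n::finite set set \<Rightarrow> 'n sqmat set" where
  "S_plus E = {x. psd x \<and> (\<forall>i j. i \<noteq> j \<and> {i, j} \<notin> E \<longrightarrow> x $ i $ j = 0)}"

definition S_space :: "'n::finite set set \<Rightarrow> 'n sqmat set" where
  "S_space E = span (S_plus E)"

text \<open>
  An induced subgraph is determined by its vertex set; \<open>F_ind E W\<close> is the face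
  \<open>\<F>(H)\<close> for the subgraph \<open>H\<close> induced by the vertex set \<open>W\<close>.
\<close>

definition F_ind :: "'n::finite set set \<Rightarrow> 'n set \<Rightarrow> 'n sqmat set" where
  "F_ind E W = {x \<in> S_plus E. \<forall>i. i \<notin> W \<longrightarrow> x $ i $ i = 0}"

definition L_plus :: "'n::{finite,linorder} set set \<Rightarrow> 'n sqmat set" where
  "L_plus E = {l. (\<forall>i j. i < j \<longrightarrow> l $ i $ j = 0) \<and> (\<forall>i. 0 \<le> l $ i $ i) \<and>
     (\<forall>i j. i \<noteq> j \<and> {i, j} \<notin> E \<longrightarrow> l $ i $ j = 0)}"

definition L_plusplus :: "'n::{finite,linorder} set set \<Rightarrow> 'n sqmat set" where
  "L_plusplus E = {l. (\<forall>i j. i < j \<longrightarrow> l $ i $ j = 0) \<and> (\<forall>i. 0 < l $ i $ i) \<and>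
     (\<forall>i j. i \<noteq> j \<and> {i, j} \<notin> E \<longrightarrow> l $ i $ j = 0)}"

definition proper :: "'n::finite sqmat \<Rightarrow> bool" where
  "proper t \<longleftrightarrow> (\<forall>i. t $ i $ i = 0 \<longrightarrow> column i t = 0)"

definition pi_G :: "'n::finite set set \<Rightarrow> 'n sqmat \<Rightarrow> 'n sqmat" where
  "pi_G E a = (\<chi> i j. if i \<noteq> j \<and> {i, j} \<notin> E then 0 else a $ i $ j)"

definition star :: "'n::finite set set \<Rightarrow> 'n sqmat \<Rightarrow> 'n sqmat \<Rightarrow> 'n sqmat" where
  "star E a b = pi_G E (a ** b)"

text \<open>
  The formula makes sense for every matrix \<open>b\<close>; only its values on \<open>S_space E\<close> matter.
\<close>

definition Q_map :: "'n::finite set set \<Rightarrow> 'n sqmat \<Rightarrow> 'n sqmat \<Rightarrow> 'n sqmat" where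
  "Q_map E l b =
     (let c = star E l (star E b (transpose l)) + star E l (star E l b) - star E (star E l l) b
      in (1/2) *\<^sub>R (c + transpose c))"

definition e_diag :: "'n::finite set \<Rightarrow> 'n sqmat" where
  "e_diag I = (\<chi> i j. if i = j \<and> i \<notin> I then 1 else 0)"

text \<open>
  This differs from the library's \<open>face_of\<close>, which also admits the empty set; \<open>convex_cone\<close>
  includes nonemptiness.
\<close>

definition cone_face :: "'a::real_vector set \<Rightarrow> 'a set \<Rightarrow> bool" where
  "cone_face F K \<longleftrightarrow> F \<subseteq> K \<and> convex_cone F \<and>
     (\<forall>x\<in>K. \<forall>y\<in>K. x + y \<in> F \<longrightarrow> x \<in> F \<and> y \<in> F)"

text \<open>
  The ambient space is a subspace \<open>A\<close> of the type, so linearity is required on \<open>A\<close> only.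
\<close>

definition linear_self_map :: "'a::real_vector set \<Rightarrow> ('a \<Rightarrow> 'a) \<Rightarrow> bool" where
  "linear_self_map A f \<longleftrightarrow> (\<forall>x\<in>A. f x \<in> A) \<and>
     (\<forall>x\<in>A. \<forall>y\<in>A. f (x + y) = f x + f y) \<and> (\<forall>c. \<forall>x\<in>A. f (c *\<^sub>R x) = c *\<^sub>R f x)"

definition projectionally_exposed :: "'a::real_vector set \<Rightarrow> 'a set \<Rightarrow> 'a set \<Rightarrow> bool" where
  "projectionally_exposed A K F \<longleftrightarrow>
     (\<exists>P. linear_self_map A P \<and> (\<forall>x\<in>A. P (P x) = P x) \<and> P ` K = F)"

definition cone_automorphism :: "'a::real_vector set \<Rightarrow> 'a set \<Rightarrow> ('a \<Rightarrow> 'a) \<Rightarrow> bool" where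
  "cone_automorphism A K Q \<longleftrightarrow> linear_self_map A Q \<and> bij_betw Q A A \<and> Q ` K = K"

end

theory Submission
  imports Defs
begin

text \<open>
  The edges of a homogeneous chordal graph are the comparable pairs of a partial order
  \<open>\<sqsubseteq>\<close> on the vertices in which all elements above a given one form a chain (a forest order).
  Under a trivially perfect elimination ordering one takes for \<open>\<sqsubseteq>\<close> the numerical order
  restricted to edges: (o2) is transitivity and (o1) is the chain condition.  Without such an
  ordering, ordering the vertices by inclusion of closed neighbourhoods works, because a pair of
  adjacent vertices with incomparable neighbourhoods would produce an induced path on four vertices
  or a chordless cycle of length four (\<open>no_two_private_neighbours\<close>, \<open>forest_order_exists\<close>).
  Working with \<open>\<sqsubseteq>\<close> directly treats both cases at once and makes a renumbering of
  the vertices unnecessary.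

  Call a matrix \<open>l\<close> triangular if \<open>l $ i $ j \<noteq> 0\<close> forces \<open>j \<sqsubseteq> i\<close>.  By transitivity the triangular
  matrices form an algebra, and those with positive diagonal form a group (\<open>tri_pos_inverse\<close>).  The
  chain condition gives the key fact \<open>pattern_tri_mult\<close>: for \<open>y\<close> with the sparsity pattern of
  the graph, the plain product \<open>l ** y\<close> has that pattern again.  Hence \<open>y \<mapsto> l ** y ** transpose l\<close>
  maps \<open>\<S>\<^sub>+(G)\<close> into itself and, with \<open>l\<close> ranging over a group, is an automorphism.  The same fact
  shows that the projections in the definition of \<open>Q\<^sub>l\<close> discard nothing, so the last two terms
  in \<open>Q\<^sub>l\<close> cancel and \<open>Q\<^sub>l\<close> is this congruence (\<open>Q_map_eq_congruence\<close>).

  Gaussian elimination, pivoting from the bottom of \<open>\<sqsubseteq>\<close> upwards, uses triangular matrices only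
  and so creates no fill-in.  It carries any \<open>x\<close> in \<open>\<S>\<^sub>+(G)\<close> to a diagonal matrix \<open>e\<^sub>I\<close> with
  entries 0 and 1 (\<open>diagonalize\<close>).  If \<open>x\<close> lies in the relative interior of the face \<open>F\<close>, then \<open>F\<close>
  is the smallest face containing \<open>x\<close>, so its image is the smallest face containing \<open>e\<^sub>I\<close>, which is
  the face of the subgraph obtained by removing \<open>I\<close> (\<open>face_image\<close>).  That face is the image of the
  cone under the projection \<open>y \<mapsto> e\<^sub>I ** y ** e\<^sub>I\<close>, and conjugating this projection with the
  automorphism exposes \<open>F\<close>.  The set \<open>I\<close> depends only on \<open>F\<close> (\<open>vertex_set_mono\<close>), which is
  why every factorisation in (ii) leads to the same subgraph as (i).
\<close>

section \<open>Congruences and positive semidefinite matrices\<close>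

definition congruence :: "'n::finite sqmat \<Rightarrow> 'n sqmat \<Rightarrow> 'n sqmat" where
  "congruence a x = a ** x ** transpose a"

lemma linear_congruence: "linear (congruence a)"
  by (rule linearI)
    (simp_all add: congruence_def matrix_matrix_mult_def vec_eq_iff transpose_def sum.distrib
      algebra_simps sum_distrib_left sum_distrib_right)

lemma congruence_congruence: "congruence a (congruence b x) = congruence (a ** b) x"
  by (simp add: congruence_def matrix_transpose_mul matrix_mul_assoc)

lemma congruence_one: "congruence (mat 1) x = x"
  by (simp add: congruence_def transpose_mat)

lemma psd_congruence:
  assumes "psd x"
  shows "psd (congruence a x)"
proof -
  have "transpose (congruence a x) = congruence a x"
    using assms by (simp add: psd_def congruence_def matrix_transpose_mul matrix_mul_assoc)
  moreover have "0 \<le> v \<bullet> (congruence a x *v v)" for v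
  proof -
    have "v \<bullet> (congruence a x *v v) = v \<bullet> (a *v (x *v (transpose a *v v)))"
      by (simp add: congruence_def matrix_vector_mul_assoc matrix_mul_assoc del: transpose_matrix_vector)
    also have "\<dots> = (transpose a *v v) \<bullet> (x *v (transpose a *v v))"
      by (metis dot_lmul_matrix transpose_matrix_vector)
    also have "\<dots> \<ge> 0"
      using assms unfolding psd_def by blast
    finally show ?thesis .
  qed
  ultimately show ?thesis
    by (simp add: psd_def)
qed

lemma inner_matrix_vector: "v \<bullet> (x *v w) = (\<Sum>i\<in>UNIV. \<Sum>j\<in>UNIV. v $ i * x $ i $ j * w $ j)"
  for x :: "'n::finite sqmat"
  by (simp add: inner_vec_def matrix_vector_mult_def sum_distrib_left mult.assoc)

lemma psd_symmetric: "psd x \<Longrightarrow> x $ i $ j = x $ j $ i"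
  unfolding psd_def transpose_def by (auto simp: vec_eq_iff)

lemma psd_diagonal_nonneg:
  assumes "psd x"
  shows "0 \<le> x $ i $ i"
proof -
  have "0 \<le> axis i 1 \<bullet> (x *v axis i 1)"
    using assms by (simp add: psd_def)
  then show ?thesis
    by (simp add: matrix_vector_mult_basis column_def inner_axis')
qed

text \<open>
  Otherwise the quadratic form, restricted to the plane spanned by the basis vectors \<open>i\<close> and \<open>j\<close>,
  would be affine and nonconstant along a line parallel to the basis vector \<open>i\<close>.
\<close>

lemma psd_zero_diagonal:
  assumes "psd x" and "x $ i $ i = 0"
  shows "x $ i $ j = 0"
proof (rule ccontr)
  assume nz: "x $ i $ j \<noteq> 0"
  \<comment> \<open>chosen so that the affine function takes the value \<open>-1\<close>\<close>
  define s where "s = - (x $ j $ j + 1) / (2 * x $ i $ j)"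
  have "0 \<le> (axis j 1 + s *\<^sub>R axis i 1) \<bullet> (x *v (axis j 1 + s *\<^sub>R axis i 1))"
    using assms by (simp add: psd_def)
  also have "\<dots> = x $ j $ j + 2 * s * x $ i $ j"
    using assms(2) psd_symmetric[OF assms(1), of i j]
    by (simp add: matrix_vector_right_distrib inner_add_left inner_add_right inner_axis'
        matrix_vector_mult_scaleR matrix_vector_mult_basis column_def)
  also have "\<dots> = -1"
    using nz by (simp add: s_def field_simps)
  finally show False
    by simp
qed

lemma e_diag_mult: "(e_diag I ** x) $ i $ j = (if i \<in> I then 0 else x $ i $ j)"
proof -
  have "e_diag I $ i $ q * x $ q $ j = (if q = i then (if i \<in> I then 0 else x $ q $ j) else 0)" for q
    by (simp add: e_diag_def)
  then show ?thesis
    by (simp add: matrix_matrix_mult_def)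
qed

lemma mult_e_diag: "(x ** e_diag I) $ i $ j = (if j \<in> I then 0 else x $ i $ j)"
proof -
  have "x $ i $ q * e_diag I $ q $ j = (if q = j then (if j \<in> I then 0 else x $ i $ q) else 0)" for q
    by (simp add: e_diag_def)
  then show ?thesis
    by (simp add: matrix_matrix_mult_def)
qed

lemma transpose_e_diag: "transpose (e_diag I) = e_diag I"
  by (auto simp: transpose_def e_diag_def vec_eq_iff)

lemma congruence_e_diag: "congruence (e_diag I) x $ i $ j = (if i \<in> I \<or> j \<in> I then 0 else x $ i $ j)"
  by (simp add: congruence_def e_diag_mult mult_e_diag transpose_e_diag)

lemma matrix_mult_nonzero:
  fixes a b :: "'n::finite sqmat"
  assumes "(a ** b) $ i $ j \<noteq> 0"
  obtains p where "a $ i $ p \<noteq> 0" "b $ p $ j \<noteq> 0"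
proof -
  have "(\<Sum>p\<in>UNIV. a $ i $ p * b $ p $ j) \<noteq> 0"
    using assms by (simp add: matrix_matrix_mult_def)
  then obtain p where "a $ i $ p * b $ p $ j \<noteq> 0"
    by (meson sum.not_neutral_contains_not_neutral)
  then show ?thesis
    using that by auto
qed

section \<open>Triangular matrices over a forest order\<close>

text \<open>
  The order is a plain relation rather than an instance of a type class, since the index type
  already carries a linear order and \<open>\<sqsubseteq>\<close> depends on the graph.  The upper sets are chains, so the
  roots of the forest are the maximal elements.
\<close>

locale forest_order =
  fixes E :: "'n::finite set set"
    and le :: "'n \<Rightarrow> 'n \<Rightarrow> bool"  (infix "\<sqsubseteq>" 50)
  assumes le_refl: "i \<sqsubseteq> i"
    and le_antisym: "i \<sqsubseteq> j \<Longrightarrow> j \<sqsubseteq> i \<Longrightarrow> i = j"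
    and le_trans: "i \<sqsubseteq> j \<Longrightarrow> j \<sqsubseteq> k \<Longrightarrow> i \<sqsubseteq> k"
    and edge_iff: "i \<noteq> j \<Longrightarrow> {i, j} \<in> E \<longleftrightarrow> i \<sqsubseteq> j \<or> j \<sqsubseteq> i"
    and upper_chain: "p \<sqsubseteq> i \<Longrightarrow> p \<sqsubseteq> j \<Longrightarrow> i \<sqsubseteq> j \<or> j \<sqsubseteq> i"
begin

text \<open>
  The triangular matrices are the incidence algebra of the order; for a trivially perfect elimination
  ordering, those satisfying \<open>tri_pos\<close> are exactly \<open>\<L>\<^sub>+\<^sub>+(G)\<close>.
\<close>

definition tri :: "'n sqmat \<Rightarrow> bool" where
  "tri l \<longleftrightarrow> (\<forall>i j. l $ i $ j \<noteq> 0 \<longrightarrow> j \<sqsubseteq> i)"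

definition tri_pos :: "'n sqmat \<Rightarrow> bool" where
  "tri_pos l \<longleftrightarrow> tri l \<and> (\<forall>i. 0 < l $ i $ i)"

definition pattern :: "'n sqmat \<Rightarrow> bool" where
  "pattern y \<longleftrightarrow> (\<forall>i j. y $ i $ j \<noteq> 0 \<longrightarrow> i \<sqsubseteq> j \<or> j \<sqsubseteq> i)"

lemma S_plus_iff: "x \<in> S_plus E \<longleftrightarrow> psd x \<and> pattern x"
proof -
  have "i \<noteq> j \<and> {i, j} \<notin> E \<longleftrightarrow> \<not> (i \<sqsubseteq> j \<or> j \<sqsubseteq> i)" for i j
    using edge_iff le_refl by metis
  then show ?thesis
    by (auto simp: S_plus_def pattern_def)
qed

text \<open>A vertex of \<open>A\<close> with the fewest vertices below it is minimal in \<open>A\<close>.\<close>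

lemma obtain_minimal:
  assumes "A \<noteq> {}"
  obtains p where "p \<in> A" "\<And>q. q \<in> A \<Longrightarrow> q \<sqsubseteq> p \<Longrightarrow> q = p"
proof -
  obtain p where p: "p \<in> A" and min: "\<And>q. q \<in> A \<Longrightarrow> card {r. r \<sqsubseteq> p} \<le> card {r. r \<sqsubseteq> q}"
    using assms ex_has_least_nat[of "\<lambda>p. p \<in> A" _ "\<lambda>p. card {r. r \<sqsubseteq> p}"] by blast
  have "q = p" if q: "q \<in> A" "q \<sqsubseteq> p" for q
  proof (rule ccontr)
    assume "q \<noteq> p"
    then have "{r. r \<sqsubseteq> q} \<subset> {r. r \<sqsubseteq> p}"
      using q(2) le_trans le_antisym le_refl by blast
    then have "card {r. r \<sqsubseteq> q} < card {r. r \<sqsubseteq> p}"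
      by (simp add: psubset_card_mono)
    then show False
      using min[OF q(1)] by simp
  qed
  with p show ?thesis
    by (rule that)
qed

lemma tri_mult:
  assumes "tri a" "tri b"
  shows "tri (a ** b)"
  unfolding tri_def
proof (intro allI impI)
  fix i j assume "(a ** b) $ i $ j \<noteq> 0"
  then obtain p where "a $ i $ p \<noteq> 0" "b $ p $ j \<noteq> 0"
    by (rule matrix_mult_nonzero)
  with assms have "p \<sqsubseteq> i" "j \<sqsubseteq> p"
    by (auto simp: tri_def)
  then show "j \<sqsubseteq> i"
    using le_trans by blast
qed

lemma tri_mult_diagonal:
  assumes "tri a" "tri b"
  shows "(a ** b) $ i $ i = a $ i $ i * b $ i $ i"
proof -
  have "(a ** b) $ i $ i = (\<Sum>p\<in>UNIV. a $ i $ p * b $ p $ i)"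
    by (simp add: matrix_matrix_mult_def)
  also have "\<dots> = (\<Sum>p\<in>{i}. a $ i $ p * b $ p $ i)"
  proof (rule sum.mono_neutral_right)
    show "\<forall>p\<in>UNIV - {i}. a $ i $ p * b $ p $ i = 0"
      using assms le_antisym unfolding tri_def by fastforce
  qed auto
  finally show ?thesis
    by simp
qed

lemma tri_pos_mult: "tri_pos a \<Longrightarrow> tri_pos b \<Longrightarrow> tri_pos (a ** b)"
  by (simp add: tri_pos_def tri_mult tri_mult_diagonal)

lemma tri_pos_one: "tri_pos (mat 1)"
  by (auto simp: tri_pos_def tri_def mat_def le_refl)

text \<open>
  Forward substitution: at a minimal index of \<open>P\<close> where \<open>v\<close> does not vanish, only the diagonal
  term of the equation survives.  With \<open>P\<close> always true this is injectivity of \<open>l\<close>; with \<open>P\<close> the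
  indices not above \<open>j\<close>, and \<open>v\<close> a column of the inverse, it shows that the inverse is triangular.
\<close>

lemma tri_pos_solve:
  assumes l: "tri_pos l"
    and zero: "\<And>i. P i \<Longrightarrow> (l *v v) $ i = 0"
    and down: "\<And>i p. P i \<Longrightarrow> p \<sqsubseteq> i \<Longrightarrow> \<not> P p \<Longrightarrow> v $ p = 0"
    and i: "P i"
  shows "v $ i = 0"
proof (rule ccontr)
  assume "v $ i \<noteq> 0"
  with i have "{i. P i \<and> v $ i \<noteq> 0} \<noteq> {}"
    by blast
  then obtain k where k: "P k" "v $ k \<noteq> 0"
    and min: "\<And>q. P q \<Longrightarrow> v $ q \<noteq> 0 \<Longrightarrow> q \<sqsubseteq> k \<Longrightarrow> q = k"
    by (rule obtain_minimal) blast
  have "(l *v v) $ k = (\<Sum>p\<in>UNIV. l $ k $ p * v $ p)"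
    by (simp add: matrix_vector_mult_def)
  also have "\<dots> = (\<Sum>p\<in>{k}. l $ k $ p * v $ p)"
  proof (rule sum.mono_neutral_right)
    show "\<forall>p\<in>UNIV - {k}. l $ k $ p * v $ p = 0"
    proof
      fix p assume p: "p \<in> UNIV - {k}"
      have "p \<sqsubseteq> k" if "l $ k $ p \<noteq> 0"
        using l that by (simp add: tri_pos_def tri_def)
      with p show "l $ k $ p * v $ p = 0"
        using min[of p] down[OF k(1), of p] by auto
    qed
  qed auto
  finally have "l $ k $ k * v $ k = 0"
    using zero[OF k(1)] by simp
  with k(2) l show False
    by (metis tri_pos_def less_irrefl mult_eq_0_iff)
qed

lemma tri_pos_inverse:
  assumes l: "tri_pos l"
  obtains m where "tri_pos m" "l ** m = mat 1" "m ** l = mat 1"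
proof -
  have "v = 0" if "l *v v = 0" for v
    using tri_pos_solve[OF l, of "\<lambda>_. True" v] that by (simp add: vec_eq_iff)
  then obtain m where ml: "m ** l = mat 1"
    using matrix_left_invertible_ker by blast
  then have lm: "l ** m = mat 1"
    using matrix_left_right_inverse by blast
  have "m $ i $ j = 0" if "\<not> j \<sqsubseteq> i" for i j
  proof -
    have "column j m $ i = 0"
    proof (rule tri_pos_solve[OF l])
      fix i assume "\<not> j \<sqsubseteq> i"
      then have "i \<noteq> j"
        using le_refl by blast
      then have "(l ** m) $ i $ j = 0"
        by (simp add: lm mat_def)
      then show "(l *v column j m) $ i = 0"
        by (simp add: matrix_matrix_mult_def matrix_vector_mult_def column_def)
    qed (use that le_trans in blast)+
    then show ?thesis
      by (simp add: column_def)
  qed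
  then have m: "tri m"
    by (auto simp: tri_def)
  have "0 < m $ i $ i" for i
  proof -
    have "l $ i $ i * m $ i $ i = 1"
      using tri_mult_diagonal[of l m i] l m lm by (simp add: tri_pos_def mat_def)
    moreover have "0 < l $ i $ i"
      using l by (simp add: tri_pos_def)
    ultimately show ?thesis
      by (metis zero_less_mult_pos zero_less_one)
  qed
  with m have "tri_pos m"
    by (simp add: tri_pos_def)
  then show ?thesis
    using lm ml by (rule that)
qed

section \<open>Triangular congruences are automorphisms\<close>

text \<open>
  A nonzero entry at \<open>(i, j)\<close> comes from some \<open>p \<sqsubseteq> i\<close> comparable with \<open>j\<close>.  If \<open>j \<sqsubseteq> p\<close>, then
  \<open>j \<sqsubseteq> i\<close> by transitivity; if \<open>p \<sqsubseteq> j\<close>, then \<open>i\<close> and \<open>j\<close> lie in the chain above \<open>p\<close>.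
\<close>

lemma pattern_tri_mult: "tri l \<Longrightarrow> pattern y \<Longrightarrow> pattern (l ** y)"
  unfolding pattern_def tri_def
  by (metis matrix_mult_nonzero le_trans upper_chain)

lemma pattern_transpose: "pattern (transpose y) \<longleftrightarrow> pattern y"
  by (auto simp: pattern_def transpose_def)

lemma pattern_mult_transpose: "tri l \<Longrightarrow> pattern y \<Longrightarrow> pattern (y ** transpose l)"
  using pattern_tri_mult[of l "transpose y"] pattern_transpose[of "y ** transpose l"]
  by (simp add: matrix_transpose_mul pattern_transpose)

lemma congruence_S_plus: "tri l \<Longrightarrow> x \<in> S_plus E \<Longrightarrow> congruence l x \<in> S_plus E"
  by (simp add: S_plus_iff psd_congruence)
    (simp add: congruence_def pattern_mult_transpose pattern_tri_mult)

lemma e_diag_S_plus: "e_diag I \<in> S_plus E"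
proof -
  have "v \<bullet> (e_diag I *v v) = (\<Sum>i\<in>UNIV. if i \<in> I then 0 else v $ i * v $ i)" for v
    by (auto simp: inner_matrix_vector e_diag_def if_distrib if_distribR sum.delta cong: if_cong intro!: sum.cong)
  then show ?thesis
    by (auto simp: S_plus_iff psd_def pattern_def e_diag_def transpose_def vec_eq_iff le_refl
        intro!: sum_nonneg)
qed

section \<open>Elimination without fill-in\<close>

text \<open>
  One pivot step.  The vertices of \<open>S\<close> are already decoupled from the rest, so a vertex joined to
  \<open>p\<close> in \<open>x\<close> lies outside \<open>S\<close> and cannot be below \<open>p\<close>, by minimality of \<open>p\<close>.  Being comparable with
  \<open>p\<close>, it is above \<open>p\<close>, and therefore the elimination matrix, which differs from the identity
  in column \<open>p\<close> only, is triangular.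
\<close>

lemma eliminate_column:
  assumes x: "x \<in> S_plus E"
    and S: "\<And>i j. i \<in> S \<Longrightarrow> j \<noteq> i \<Longrightarrow> x $ i $ j = 0"
    and p: "p \<notin> S" "\<And>q. q \<notin> S \<Longrightarrow> q \<sqsubseteq> p \<Longrightarrow> q = p"
    and pos: "0 < x $ p $ p"
  obtains l where "tri_pos l" "congruence l x $ p $ p = 1"
    "\<And>j. j \<noteq> p \<Longrightarrow> congruence l x $ p $ j = 0"
    "\<And>i j. i \<in> S \<Longrightarrow> congruence l x $ i $ j = x $ i $ j"
proof -
  have sym: "x $ i $ j = x $ j $ i" for i j
    using x psd_symmetric S_plus_iff by blast
  \<comment> \<open>\<open>d\<close> is column \<open>p\<close> of the elimination matrix \<open>l\<close>: it scales the pivot to 1 and clears the rest\<close>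
  define d where "d i = (if i = p then 1 / sqrt (x $ p $ p) else - x $ i $ p / x $ p $ p)" for i
  define l :: "'n sqmat" where
    "l = (\<chi> i j. (if i = j then (if i \<noteq> p then 1 else 0) else 0) + (if p = j then d i else 0))"
  have supp: "p \<sqsubseteq> i" if "d i \<noteq> 0" for i
  proof (cases "i = p")
    case False
    with that have nz: "x $ i $ p \<noteq> 0"
      by (auto simp: d_def)
    with False S[of i p] have "i \<notin> S"
      by auto
    moreover have "i \<sqsubseteq> p \<or> p \<sqsubseteq> i"
      using nz x by (auto simp: S_plus_iff pattern_def)
    ultimately show ?thesis
      using p(2) False by blast
  qed (simp add: le_refl)
  have l: "tri_pos l"
    using pos supp by (auto simp: tri_pos_def tri_def l_def le_refl d_def split: if_splits)
  define z where "z = l ** x"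
  have z: "z $ i $ j = (if i \<noteq> p then x $ i $ j else 0) + d i * x $ p $ j" for i j
    by (simp add: z_def l_def matrix_matrix_mult_def distrib_right sum.distrib if_distribR
        if_distrib[of "\<lambda>u. u * _"] cong: if_cong)
  have c: "congruence l x $ i $ j = (if j \<noteq> p then z $ i $ j else 0) + d j * z $ i $ p" for i j
    unfolding congruence_def z_def[symmetric]
    by (simp add: l_def matrix_matrix_mult_def transpose_def distrib_left sum.distrib if_distribR
        if_distrib[of "\<lambda>u. _ * u"] cong: if_cong)
  have S0: "d i = 0 \<and> x $ i $ p = 0 \<and> i \<noteq> p" if "i \<in> S" for i
    using S[OF that, of p] that p(1) by (auto simp: d_def)
  show ?thesis
  proof (rule that[OF l])
    show "congruence l x $ p $ p = 1"
      using pos by (simp add: c z d_def)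
    show "congruence l x $ p $ j = 0" if "j \<noteq> p" for j
      using that pos by (simp add: c z d_def sym[of j p] field_simps)
    show "congruence l x $ i $ j = x $ i $ j" if "i \<in> S" for i j
      using S0[OF that] by (cases "j = p") (simp_all add: c z)
  qed
qed

lemma diagonalize_partial:
  assumes "x \<in> S_plus E"
    and "\<And>i j. i \<in> S \<Longrightarrow> j \<noteq> i \<Longrightarrow> x $ i $ j = 0"
    and "\<And>i. i \<in> S \<Longrightarrow> x $ i $ i \<in> {0, 1}"
  shows "\<exists>l I. tri_pos l \<and> congruence l x = e_diag I"
  using assms
proof (induction "card (- S)" arbitrary: S x rule: less_induct)
  case less
  show ?case
  proof (cases "S = UNIV")
    case True
    have "x = e_diag {i. x $ i $ i = 0}"
    proof -
      have "x $ i $ j = e_diag {i. x $ i $ i = 0} $ i $ j" for i j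
        using less.prems(2)[of i j] less.prems(3)[of i] by (auto simp: True e_diag_def)
      then show ?thesis
        unfolding vec_eq_iff by blast
    qed
    then show ?thesis
      using tri_pos_one congruence_one by metis
  next
    case False
    then have "- S \<noteq> {}"
      by blast
    then obtain p where p: "p \<notin> S" "\<And>q. q \<notin> S \<Longrightarrow> q \<sqsubseteq> p \<Longrightarrow> q = p"
      by (rule obtain_minimal) blast
    have card: "card (- insert p S) < card (- S)"
      using p(1) by (intro psubset_card_mono) auto
    have psd: "psd x"
      using less.prems(1) by (simp add: S_plus_iff)
    show ?thesis
    proof (cases "x $ p $ p = 0")
      \<comment> \<open>a zero pivot needs no elimination: by semidefiniteness its row vanishes already\<close>
      case True
      show ?thesis
        by (rule less.hyps[OF card less.prems(1)])
          (use True less.prems psd_zero_diagonal[OF psd True] in auto)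
    next
      case False
      then have "0 < x $ p $ p"
        using psd_diagonal_nonneg[OF psd, of p] by simp
      then obtain a where a: "tri_pos a" "congruence a x $ p $ p = 1"
        "\<And>j. j \<noteq> p \<Longrightarrow> congruence a x $ p $ j = 0"
        "\<And>i j. i \<in> S \<Longrightarrow> congruence a x $ i $ j = x $ i $ j"
        using eliminate_column[OF less.prems(1,2) p] by blast
      have "congruence a x \<in> S_plus E"
        using a(1) less.prems(1) by (simp add: congruence_S_plus tri_pos_def)
      then have "\<exists>l I. tri_pos l \<and> congruence l (congruence a x) = e_diag I"
      proof (rule less.hyps[OF card])
        fix i j assume i: "i \<in> insert p S"
        show "congruence a x $ i $ j = 0" if "j \<noteq> i"
          using that i a(3,4) less.prems(2) by (cases "i = p") auto
        show "congruence a x $ i $ i \<in> {0, 1}"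
          using i a(2,4) less.prems(3) by (cases "i = p") auto
      qed
      then show ?thesis
        using a(1) tri_pos_mult by (metis congruence_congruence)
    qed
  qed
qed

lemma diagonalize:
  assumes "x \<in> S_plus E"
  obtains l I where "tri_pos l" "congruence l x = e_diag I"
  using diagonalize_partial[OF assms, of "{}"] by auto

lemma congruence_S_space:
  assumes "\<And>x. x \<in> S_plus E \<Longrightarrow> congruence a x \<in> S_plus E" and "x \<in> S_space E"
  shows "congruence a x \<in> S_space E"
proof -
  have "congruence a ` span (S_plus E) = span (congruence a ` S_plus E)"
    by (rule linear_span_image[OF linear_congruence, symmetric])
  also have "\<dots> \<subseteq> span (S_plus E)"
    using assms(1) by (intro span_mono) auto
  finally show ?thesis
    using assms(2) by (auto simp: S_space_def)
qed

lemma linear_self_map_congruence: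
  assumes "\<And>x. x \<in> S_plus E \<Longrightarrow> congruence a x \<in> S_plus E"
  shows "linear_self_map (S_space E) (congruence a)"
  unfolding linear_self_map_def
  using congruence_S_space[OF assms]
    linear_add[OF linear_congruence] linear_scale[OF linear_congruence] by blast

lemma cone_automorphism_congruence:
  assumes l: "tri_pos l"
  shows "cone_automorphism (S_space E) (S_plus E) (congruence l)"
proof -
  obtain m where m: "tri_pos m" and inv: "l ** m = mat 1" "m ** l = mat 1"
    using tri_pos_inverse[OF l] by blast
  have maps: "\<And>a x. tri_pos a \<Longrightarrow> x \<in> S_plus E \<Longrightarrow> congruence a x \<in> S_plus E"
    by (simp add: congruence_S_plus tri_pos_def)
  have cancel: "\<And>x. congruence l (congruence m x) = x" "\<And>x. congruence m (congruence l x) = x"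
    by (simp_all add: congruence_congruence inv congruence_one)
  have "linear_self_map (S_space E) (congruence l)"
    using linear_self_map_congruence maps l by blast
  moreover have "bij_betw (congruence l) (S_space E) (S_space E)"
    by (rule bij_betw_byWitness[where f' = "congruence m"])
      (use cancel congruence_S_space maps l m in blast)+
  moreover have "congruence l ` S_plus E = S_plus E"
  proof
    show "congruence l ` S_plus E \<subseteq> S_plus E"
      using maps[OF l] by blast
    show "S_plus E \<subseteq> congruence l ` S_plus E"
      using maps[OF m] cancel(1) by (metis image_eqI subsetI)
  qed
  ultimately show ?thesis
    by (simp add: cone_automorphism_def)
qed

section \<open>Faces in standard position\<close>

text \<open>
  The form of \<open>y\<close> involves only coordinates outside \<open>I\<close>, and on these \<open>e_diag I\<close> is the sum of
  squares.  So a small multiple of \<open>y\<close> can be subtracted: \<open>e_diag I\<close> is a relative interior point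
  of \<open>F_ind E (UNIV - I)\<close>.
\<close>

lemma e_diag_minus_S_plus:
  assumes y: "y \<in> F_ind E (UNIV - I)"
  obtains r where "0 < r" "e_diag I - r *\<^sub>R y \<in> S_plus E"
proof -
  have yS: "y \<in> S_plus E" and y0: "\<And>i. i \<in> I \<Longrightarrow> y $ i $ i = 0"
    using y by (auto simp: F_ind_def)
  have psd: "psd y" and pat: "pattern y"
    using yS by (auto simp: S_plus_iff)
  have zero: "y $ i $ j = 0" if "i \<in> I \<or> j \<in> I" for i j
    using that psd_zero_diagonal[OF psd] y0 psd_symmetric[OF psd] by metis
  define b where "b = (\<Sum>i\<in>UNIV. \<Sum>j\<in>UNIV. \<bar>y $ i $ j\<bar>)"
  have b: "0 \<le> b"
    by (simp add: b_def sum_nonneg)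
  have bound: "v \<bullet> (y *v v) \<le> b * (v \<bullet> (e_diag I *v v))" for v
  proof -
    define s where "s = (\<Sum>k\<in>UNIV - I. (v $ k)\<^sup>2)"
    have "(\<Sum>j\<in>UNIV. v $ i * e_diag I $ i $ j * v $ j) = (if i \<in> UNIV - I then (v $ i)\<^sup>2 else 0)" for i
      by (auto simp: e_diag_def if_distrib if_distribR sum.delta power2_eq_square cong: if_cong)
    then have s: "v \<bullet> (e_diag I *v v) = s"
      by (simp add: inner_matrix_vector s_def flip: sum.inter_filter) (simp add: set_diff_eq)
    have "v $ i * y $ i $ j * v $ j \<le> \<bar>y $ i $ j\<bar> * s" for i j
    proof (cases "i \<in> I \<or> j \<in> I")
      case True
      then show ?thesis
        by (simp add: zero)
    next
      case False
      have sq: "(v $ k)\<^sup>2 \<le> s" if "k \<notin> I" for k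
        unfolding s_def using that by (intro member_le_sum) auto
      have "\<bar>v $ i * v $ j\<bar> \<le> ((v $ i)\<^sup>2 + (v $ j)\<^sup>2) / 2"
        using sum_squares_bound[of "\<bar>v $ i\<bar>" "\<bar>v $ j\<bar>"] by (simp add: abs_mult)
      also have "\<dots> \<le> s"
        using sq[of i] sq[of j] False by simp
      finally have "\<bar>y $ i $ j\<bar> * \<bar>v $ i * v $ j\<bar> \<le> \<bar>y $ i $ j\<bar> * s"
        by (simp add: mult_left_mono)
      moreover have "v $ i * y $ i $ j * v $ j \<le> \<bar>y $ i $ j\<bar> * \<bar>v $ i * v $ j\<bar>"
        using abs_ge_self[of "v $ i * y $ i $ j * v $ j"] by (simp add: abs_mult mult.commute mult.left_commute)
      ultimately show ?thesis
        by simp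
    qed
    then have "v \<bullet> (y *v v) \<le> (\<Sum>i\<in>UNIV. \<Sum>j\<in>UNIV. \<bar>y $ i $ j\<bar> * s)"
      unfolding inner_matrix_vector by (intro sum_mono)
    then show ?thesis
      by (simp add: s b_def sum_distrib_right)
  qed
  define r where "r = 1 / (1 + b)"
  have r: "0 < r" "r * b \<le> 1"
    using b by (auto simp: r_def)
  have e: "psd (e_diag I)" "pattern (e_diag I)"
    using e_diag_S_plus by (auto simp: S_plus_iff)
  have "0 \<le> v \<bullet> ((e_diag I - r *\<^sub>R y) *v v)" for v
  proof -
    define q where "q = v \<bullet> (e_diag I *v v)"
    have "0 \<le> q"
      using e(1) by (simp add: psd_def q_def)
    have "r * (v \<bullet> (y *v v)) \<le> r * (b * q)"
      using bound r(1) by (simp add: q_def)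
    also have "\<dots> \<le> q"
      using mult_right_mono[OF r(2) \<open>0 \<le> q\<close>] by (simp add: mult.assoc)
    finally show ?thesis
      by (simp add: q_def matrix_vector_mult_diff_rdistrib inner_diff_right
          scaleR_matrix_vector_assoc[symmetric])
  qed
  moreover have "transpose (e_diag I - r *\<^sub>R y) = e_diag I - r *\<^sub>R y"
    using psd_symmetric[OF psd] psd_symmetric[OF e(1)] by (simp add: vec_eq_iff transpose_def)
  moreover have "pattern (e_diag I - r *\<^sub>R y)"
    using e(2) pat unfolding pattern_def vector_minus_component vector_scaleR_component
    by (metis diff_self mult_zero_right real_scaleR_def)
  ultimately show ?thesis
    using that[OF r(1)] by (simp add: S_plus_iff psd_def)
qed

text \<open>
  One inclusion prolongs the segment from a point of \<open>F\<close> to the relative interior point \<open>x\<close> a little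
  beyond \<open>x\<close>: diagonal entries in \<open>I\<close> vanish at \<open>x\<close> and are nonnegative at both ends, so
  they vanish at the ends.  The other splits \<open>e_diag I\<close> as a sum with a multiple of the given element
  as a summand and uses the defining property of a face.
\<close>

lemma face_image:
  assumes face: "cone_face F (S_plus E)"
    and x: "x \<in> rel_interior F"
    and l: "tri_pos l" "congruence l x = e_diag I"
  shows "congruence l ` F = F_ind E (UNIV - I)"
proof
  have FS: "F \<subseteq> S_plus E" and cone: "convex F" "conic F"
    and split: "\<And>u v. u \<in> S_plus E \<Longrightarrow> v \<in> S_plus E \<Longrightarrow> u + v \<in> F \<Longrightarrow> u \<in> F"
    using face by (auto simp: cone_face_def convex_cone_def)
  have tri: "tri l"
    using l(1) by (simp add: tri_pos_def)
  have xF: "x \<in> F"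
    using x rel_interior_subset by blast
  show "congruence l ` F \<subseteq> F_ind E (UNIV - I)"
  proof (rule image_subsetI)
    fix z assume z: "z \<in> F"
    then obtain e where e: "e > 1" and u: "(1 - e) *\<^sub>R z + e *\<^sub>R x \<in> F"
      using convex_rel_interior_if[OF cone(1) x] hull_inc by (metis order_refl)
    define u where "u = (1 - e) *\<^sub>R z + e *\<^sub>R x"
    have zu: "congruence l z \<in> S_plus E" "congruence l u \<in> S_plus E"
      using z u FS congruence_S_plus[OF tri] by (auto simp: u_def)
    have "congruence l u = (1 - e) *\<^sub>R congruence l z + e *\<^sub>R e_diag I"
      by (simp add: u_def linear_add[OF linear_congruence] linear_scale[OF linear_congruence] l(2))
    then have "congruence l u $ i $ i = (1 - e) * congruence l z $ i $ i" if "i \<in> I" for i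
      using that by (simp add: e_diag_def)
    moreover have "0 \<le> congruence l z $ i $ i" "0 \<le> congruence l u $ i $ i" for i
      using zu psd_diagonal_nonneg by (auto simp: S_plus_iff)
    ultimately have "congruence l z $ i $ i = 0" if "i \<in> I" for i
      using that e by (smt (verit) mult_neg_pos)
    with zu(1) show "congruence l z \<in> F_ind E (UNIV - I)"
      by (simp add: F_ind_def)
  qed
  obtain m where m: "tri_pos m" and inv: "l ** m = mat 1" "m ** l = mat 1"
    using tri_pos_inverse[OF l(1)] by blast
  have mS: "\<And>y. y \<in> S_plus E \<Longrightarrow> congruence m y \<in> S_plus E"
    using m by (simp add: congruence_S_plus tri_pos_def)
  show "F_ind E (UNIV - I) \<subseteq> congruence l ` F"
  proof
    fix y assume y: "y \<in> F_ind E (UNIV - I)"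
    then obtain r where r: "0 < r" "e_diag I - r *\<^sub>R y \<in> S_plus E"
      by (rule e_diag_minus_S_plus)
    have "r *\<^sub>R y \<in> S_plus E"
      using y r(1) by (auto simp: F_ind_def S_plus_def psd_def transpose_scalar scaleR_matrix_vector_assoc[symmetric])
    moreover have "congruence m (r *\<^sub>R y) + congruence m (e_diag I - r *\<^sub>R y) = x"
      using l(2)[symmetric]
      by (simp add: linear_add[OF linear_congruence, symmetric] congruence_congruence inv congruence_one)
    ultimately have "congruence m (r *\<^sub>R y) \<in> F"
      using split[of "congruence m (r *\<^sub>R y)" "congruence m (e_diag I - r *\<^sub>R y)"] mS r(2) xF by simp
    then have "(1 / r) *\<^sub>R congruence m (r *\<^sub>R y) \<in> F"
      using cone(2) r(1) by (simp add: conic_def)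
    then have "congruence m y \<in> F"
      using r(1) by (simp add: linear_scale[OF linear_congruence])
    moreover have "y = congruence l (congruence m y)"
      by (simp add: congruence_congruence inv congruence_one)
    ultimately show "y \<in> congruence l ` F"
      by blast
  qed
qed

text \<open>
  The quotient \<open>a\<close> of the two matrices maps one standard face to the other.  If \<open>i\<close> is in \<open>W\<close>, the
  diagonal entry \<open>i\<close> of the image of \<open>e_diag (- W)\<close> is at least the square of the
  positive entry \<open>a $ i $ i\<close>, so \<open>i\<close> must be in \<open>W'\<close>.  By symmetry the vertex set is unique.
\<close>

lemma vertex_set_mono:
  assumes "tri_pos l" "congruence l ` F = F_ind E W"
    and "tri_pos l'" "congruence l' ` F = F_ind E W'"
  shows "W \<subseteq> W'"
proof
  fix i assume i: "i \<in> W"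
  obtain m where m: "tri_pos m" and inv: "l ** m = mat 1" "m ** l = mat 1"
    using tri_pos_inverse[OF assms(1)] by blast
  define a where "a = l' ** m"
  have a: "tri_pos a"
    using assms(3) m by (simp add: a_def tri_pos_mult)
  have "e_diag (- W) \<in> F_ind E W"
    using e_diag_S_plus[of "- W"] by (auto simp: F_ind_def e_diag_def)
  then obtain z where z: "z \<in> F" "e_diag (- W) = congruence l z"
    using assms(2) by (metis imageE)
  have "congruence a (e_diag (- W)) = congruence l' z"
    unfolding z(2) a_def
    by (simp add: congruence_congruence inv flip: matrix_mul_assoc)
  then have img: "congruence a (e_diag (- W)) \<in> F_ind E W'"
    using assms(4) z(1) by blast
  show "i \<in> W'"
  proof (rule ccontr)
    assume "i \<notin> W'"
    with img have "0 = congruence a (e_diag (- W)) $ i $ i"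
      by (simp add: F_ind_def)
    also have "\<dots> = (\<Sum>k\<in>UNIV. (a ** e_diag (- W)) $ i $ k * a $ i $ k)"
      unfolding congruence_def
      by (subst matrix_matrix_mult_def) (simp add: transpose_def)
    also have "\<dots> = (\<Sum>k\<in>UNIV. if k \<in> W then (a $ i $ k)\<^sup>2 else 0)"
      by (auto simp: mult_e_diag power2_eq_square intro!: sum.cong)
    finally have "\<forall>k\<in>UNIV. (if k \<in> W then (a $ i $ k)\<^sup>2 else 0) = 0"
      by (subst (asm) eq_commute, subst (asm) sum_nonneg_eq_0_iff) auto
    then have "(if i \<in> W then (a $ i $ i)\<^sup>2 else 0) = 0"
      by blast
    with i have "a $ i $ i = 0"
      by simp
    with a show False
      by (metis tri_pos_def less_irrefl)
  qed
qed

text \<open>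
  Moving \<open>F\<close> to standard position by \<open>l\<close>, deleting the rows and columns in \<open>I\<close>, and moving back is
  again a congruence, by an idempotent triangular matrix.
\<close>

lemma face_projectionally_exposed:
  assumes l: "tri_pos l" and F: "congruence l ` F = F_ind E (UNIV - I)"
  shows "projectionally_exposed (S_space E) (S_plus E) F"
proof -
  obtain m where m: "tri_pos m" and inv: "l ** m = mat 1" "m ** l = mat 1"
    using tri_pos_inverse[OF l] by blast
  define e where "e = e_diag I"
  define a where "a = m ** e ** l"
  have tri: "tri e"
    by (auto simp: e_def tri_def e_diag_def le_refl)
  then have tri_a: "tri a"
    using l m by (simp add: a_def tri_pos_def tri_mult)
  have ee: "e ** e = e"
    by (auto simp: e_def e_diag_mult vec_eq_iff) (simp add: e_diag_def)
  have "a ** a = m ** e ** (l ** m) ** e ** l"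
    by (simp add: a_def matrix_mul_assoc)
  also have "\<dots> = m ** (e ** e) ** l"
    by (simp add: inv matrix_mul_assoc)
  finally have aa: "a ** a = a"
    by (simp add: ee a_def)
  have onto: "congruence e ` S_plus E = F_ind E (UNIV - I)"
  proof
    show "congruence e ` S_plus E \<subseteq> F_ind E (UNIV - I)"
      using congruence_S_plus[OF tri] by (auto simp: F_ind_def congruence_e_diag e_def)
    show "F_ind E (UNIV - I) \<subseteq> congruence e ` S_plus E"
    proof
      fix y assume y: "y \<in> F_ind E (UNIV - I)"
      then have "psd y" and zero: "\<And>i. i \<in> I \<Longrightarrow> y $ i $ i = 0" and yS: "y \<in> S_plus E"
        by (auto simp: F_ind_def S_plus_iff)
      then have "y = congruence e y"
        unfolding vec_eq_iff e_def congruence_e_diag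
        by (metis psd_zero_diagonal psd_symmetric)
      with yS show "y \<in> congruence e ` S_plus E"
        by blast
    qed
  qed
  have "congruence a ` S_plus E = congruence m ` congruence e ` congruence l ` S_plus E"
    by (simp add: image_image congruence_congruence a_def matrix_mul_assoc)
  also have "\<dots> = congruence m ` congruence l ` F"
    using cone_automorphism_congruence[OF l] by (simp add: cone_automorphism_def onto F)
  also have "\<dots> = F"
    by (simp add: image_image congruence_congruence inv congruence_one)
  finally show ?thesis
    unfolding projectionally_exposed_def
    using linear_self_map_congruence[of a] congruence_S_plus[OF tri_a] aa
    by (intro exI[of _ "congruence a"]) (simp add: congruence_congruence)
qed

text \<open>
  Filling the zero diagonal entries of \<open>t\<close> with ones gives an invertible triangular \<open>u\<close>.  Since the
  columns of \<open>t\<close> in \<open>I\<close> vanish, \<open>t = u ** e_diag I\<close>, and the inverse of \<open>u\<close> does what is required.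
\<close>

lemma proper_left_inverse:
  assumes t: "tri t" "\<And>i. 0 \<le> t $ i $ i" "proper t"
  obtains l where "tri_pos l" "l ** t = e_diag {i. t $ i $ i = 0}"
proof -
  define I where "I = {i. t $ i $ i = 0}"
  define u where "u = t + e_diag (- I)"
  have "tri_pos u"
    using t(1,2) by (auto simp: u_def tri_pos_def tri_def e_diag_def le_refl I_def order_less_le)
  then obtain l where l: "tri_pos l" "l ** u = mat 1"
    using tri_pos_inverse by metis
  have col: "t $ i $ j = 0" if "j \<in> I" for i j
    using t(3) that by (auto simp: I_def proper_def column_def vec_eq_iff)
  have "u ** e_diag I = t"
    using col by (auto simp: vec_eq_iff mult_e_diag u_def) (auto simp: e_diag_def)
  then have "l ** t = l ** u ** e_diag I"
    by (simp flip: matrix_mul_assoc)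
  also have "\<dots> = e_diag I"
    by (simp add: l(2))
  finally show ?thesis
    using that l(1) by (simp add: I_def)
qed

section \<open>The quadratic map as a congruence\<close>

lemma S_space_symmetric_pattern:
  assumes "b \<in> S_space E"
  shows "transpose b = b" "pattern b"
proof -
  have "subspace {b. transpose b = b \<and> pattern b}"
    unfolding subspace_def
    by (auto simp: pattern_def transpose_def vec_eq_iff) (metis add.right_neutral)+
  then have "S_space E \<subseteq> {b. transpose b = b \<and> pattern b}"
    unfolding S_space_def by (rule span_minimal[rotated]) (auto simp: S_plus_iff psd_def)
  with assms show "transpose b = b" "pattern b"
    by auto
qed

lemma pi_G_pattern: "pattern a \<Longrightarrow> pi_G E a = a"
  unfolding pi_G_def pattern_def vec_eq_iff using edge_iff by auto

text \<open>
  All products occurring in the definition of \<open>Q_map\<close> have the sparsity pattern already, so \<open>star\<close> is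
  the ordinary associative product and two of the three terms cancel.
\<close>

lemma Q_map_eq_congruence:
  assumes l: "tri l" and b: "b \<in> S_space E"
  shows "Q_map E l b = congruence l b"
proof -
  note sb = S_space_symmetric_pattern[OF b]
  have "pattern l"
    using l by (auto simp: pattern_def tri_def)
  then have ll: "star E l l = l ** l"
    by (simp add: star_def pi_G_pattern pattern_tri_mult l)
  have p: "pattern (b ** transpose l)" "pattern (l ** b)"
    using l sb(2) by (simp_all add: pattern_mult_transpose pattern_tri_mult)
  have "star E l (star E b (transpose l)) + star E l (star E l b) - star E (star E l l) b
      = congruence l b"
    unfolding ll
    using pattern_tri_mult[OF l p(1)] pattern_tri_mult[OF l p(2)]
    by (simp add: star_def pi_G_pattern p l congruence_def matrix_mul_assoc)
  moreover have "transpose (congruence l b) = congruence l b"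
    by (simp add: congruence_def matrix_transpose_mul sb(1) matrix_mul_assoc)
  ultimately show ?thesis
    unfolding Q_map_def Let_def by (simp flip: scaleR_2)
qed

lemma Q_map_automorphism:
  assumes l: "tri_pos l"
  shows "cone_automorphism (S_space E) (S_plus E) (Q_map E l)"
proof -
  have eq: "\<And>b. b \<in> S_space E \<Longrightarrow> Q_map E l b = congruence l b"
    using l Q_map_eq_congruence by (simp add: tri_pos_def)
  have aut: "cone_automorphism (S_space E) (S_plus E) (congruence l)"
    by (rule cone_automorphism_congruence[OF l])
  have sub: "subspace (S_space E)"
    by (simp add: S_space_def)
  have "linear_self_map (S_space E) (Q_map E l)"
    using aut eq subspace_add[OF sub] subspace_scale[OF sub]
    unfolding cone_automorphism_def linear_self_map_def by simp
  moreover have "bij_betw (Q_map E l) (S_space E) (S_space E)"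
    using aut eq bij_betw_cong[of "S_space E" "Q_map E l" "congruence l"]
    by (simp add: cone_automorphism_def)
  moreover have "Q_map E l ` S_plus E = S_plus E"
    using aut eq image_cong[of "S_plus E" "S_plus E" "Q_map E l" "congruence l"]
    by (simp add: cone_automorphism_def S_space_def span_base)
  ultimately show ?thesis
    by (simp add: cone_automorphism_def)
qed

end

section \<open>Forest orders of homogeneous chordal graphs\<close>

lemma forest_order_tpe:
  fixes E :: "'n::{finite,linorder} set set"
  assumes "simple_graph E" and tpe: "trivially_perfect_elim_order E"
  shows "forest_order E (\<lambda>i j. i = j \<or> i < j \<and> {i, j} \<in> E)"
proof
  have o1: "\<And>i j k. {i, j} \<in> E \<Longrightarrow> {i, k} \<in> E \<Longrightarrow> i < j \<Longrightarrow> j < k \<Longrightarrow> {j, k} \<in> E"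
    and o2: "\<And>i j k. {i, j} \<in> E \<Longrightarrow> {j, k} \<in> E \<Longrightarrow> i < j \<Longrightarrow> j < k \<Longrightarrow> {i, k} \<in> E"
    using tpe unfolding trivially_perfect_elim_order_def by blast+
  show "i = k \<or> i < k \<and> {i, k} \<in> E"
    if "i = j \<or> i < j \<and> {i, j} \<in> E" "j = k \<or> j < k \<and> {j, k} \<in> E" for i j k
    using that o2 by (metis less_trans)
  show "(i = j \<or> i < j \<and> {i, j} \<in> E) \<or> j = i \<or> j < i \<and> {j, i} \<in> E"
    if "p = i \<or> p < i \<and> {p, i} \<in> E" "p = j \<or> p < j \<and> {p, j} \<in> E" for p i j
  proof (cases "p = i \<or> p = j \<or> i = j")
    case True
    with that show ?thesis
      by (auto simp: insert_commute)
  next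
    case False
    with that have "p < i" "{p, i} \<in> E" "p < j" "{p, j} \<in> E" "i \<noteq> j"
      by auto
    then show ?thesis
      using o1[of p i j] o1[of p j i] by (cases i j rule: linorder_cases) auto
  qed
  show "{i, j} \<in> E \<longleftrightarrow> (i = j \<or> i < j \<and> {i, j} \<in> E) \<or> j = i \<or> j < i \<and> {j, i} \<in> E"
    if "i \<noteq> j" for i j
    using that by (metis insert_commute neqE)
qed auto

text \<open>
  The vertices \<open>a, u, v, b\<close> would form an induced path or, if \<open>a\<close> and \<open>b\<close> are adjacent, a
  chordless cycle.  So the closed neighbourhoods of adjacent vertices are nested.
\<close>

lemma no_two_private_neighbours:
  assumes G: "homogeneous_chordal E" and uv: "{u, v} \<in> E"
    and a: "a = u \<or> {u, a} \<in> E" "\<not> (a = v \<or> {v, a} \<in> E)"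
    and b: "b = v \<or> {v, b} \<in> E" "\<not> (b = u \<or> {u, b} \<in> E)"
  shows False
proof -
  have simple: "\<And>i. {i, i} \<notin> E"
    using G by (auto simp: homogeneous_chordal_def simple_graph_def)
  have edges: "{a, u} \<in> E" "{u, v} \<in> E" "{v, b} \<in> E"
    and non: "{a, v} \<notin> E" "{u, b} \<notin> E" and d: "distinct [a, u, v, b]"
    using a b uv simple by (auto simp: insert_commute)
  show False
  proof (cases "{a, b} \<in> E")
    case False
    with edges non d have "has_induced_P4 E"
      unfolding has_induced_P4_def by blast
    with G show False
      by (simp add: homogeneous_chordal_def)
  next
    case True
    have rev: "{b, a} \<in> E" "{v, a} \<notin> E" "{b, u} \<notin> E"
      using True non by (simp_all add: insert_commute)
    have "is_cycle E [a, u, v, b]"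
      using edges d rev by (simp add: is_cycle_def All_less_Suc)
    moreover have "\<not> has_chord E [a, u, v, b]"
      using non rev by (simp add: has_chord_def Ex_less_Suc)
    ultimately show False
      using G by (auto simp: homogeneous_chordal_def chordal_def)
  qed
qed

text \<open>
  Adjacent vertices are ordered by inclusion of their closed neighbourhoods \<open>N\<close>.  Distinct
  vertices with the same closed neighbourhood are ordered by the linear order of the index type,
  which makes the relation antisymmetric.
\<close>

lemma forest_order_exists:
  fixes E :: "'n::{finite,linorder} set set"
  assumes G: "homogeneous_chordal E"
  obtains le where "forest_order E le"
proof -
  define N where "N u = {a. a = u \<or> {u, a} \<in> E}" for u
  define le where "le u v \<longleftrightarrow> v \<in> N u \<and> (N u \<subset> N v \<or> N u = N v \<and> u \<le> v)" for u v
  have sym: "v \<in> N u \<longleftrightarrow> u \<in> N v" for u v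
    by (auto simp: N_def insert_commute)
  have self: "u \<in> N u" for u
    by (simp add: N_def)
  have nested: "N u \<subseteq> N v \<or> N v \<subseteq> N u" if "v \<in> N u" for u v
  proof (rule ccontr)
    assume "\<not> ?thesis"
    then obtain a b where "a \<in> N u" "a \<notin> N v" "b \<in> N v" "b \<notin> N u"
      by blast
    moreover from this have "{u, v} \<in> E"
      using that by (auto simp: N_def)
    ultimately show False
      using no_two_private_neighbours[OF G, of u v a b] by (simp add: N_def)
  qed
  have comparable: "le u v \<or> le v u" if "v \<in> N u" for u v
    using nested[OF that] that sym unfolding le_def by (metis linear psubsetI)
  have "forest_order E le"
  proof
    show "le i i" for i
      by (simp add: le_def self)
    show "i = j" if "le i j" "le j i" for i j
    proof (rule antisym)
      have "N i = N j"
        using that unfolding le_def by (metis psubset_imp_subset subset_antisym)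
      with that show "i \<le> j" "j \<le> i"
        by (simp_all add: le_def)
    qed
    show "le i k" if "le i j" "le j k" for i j k
    proof -
      have "i \<in> N j" "N j \<subseteq> N k"
        using that sym by (auto simp: le_def)
      then have "k \<in> N i"
        using sym by blast
      moreover have "N i \<subset> N k \<or> N i = N k \<and> i \<le> k"
        using that unfolding le_def by (metis order.trans psubset_trans)
      ultimately show ?thesis
        by (simp add: le_def)
    qed
    show "{i, j} \<in> E \<longleftrightarrow> le i j \<or> le j i" if "i \<noteq> j" for i j
    proof -
      have "{i, j} \<in> E \<longleftrightarrow> j \<in> N i"
        using that by (simp add: N_def)
      then show ?thesis
        using comparable sym unfolding le_def by blast
    qed
    show "le i j \<or> le j i" if "le p i" "le p j" for p i j
    proof -
      have "i \<in> N p" "N p \<subseteq> N j"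
        using that by (auto simp: le_def)
      then have "i \<in> N j"
        by blast
      then show ?thesis
        using comparable by blast
    qed
  qed
  then show ?thesis
    by (rule that)
qed

section \<open>Faces of the cone\<close>

theorem theorem4p2:
  fixes E :: "'n::{finite,linorder} set set"
    and F :: "'n sqmat set"
  assumes G: "homogeneous_chordal E"
    and face: "cone_face F (S_plus E)"
  shows "projectionally_exposed (S_space E) (S_plus E) F \<and>
    (\<exists>Q W. cone_automorphism (S_space E) (S_plus E) Q \<and> Q ` F = F_ind E W) \<and>
    (trivially_perfect_elim_order E \<longrightarrow>
      (\<exists>W.
        (\<exists>l\<in>L_plusplus E. cone_automorphism (S_space E) (S_plus E) (Q_map E l) \<and>
            Q_map E l ` F = F_ind E W \<and>
            (\<forall>y\<in>S_plus E. Q_map E l y = l ** y ** transpose l)) \<and>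
        (\<forall>x t I. x \<in> rel_interior F \<and> t \<in> L_plus E \<and> proper t \<and> x = t ** transpose t \<and>
            I = {i. t $ i $ i = 0} \<longrightarrow>
            W = UNIV - I \<and>
            (\<exists>l\<in>L_plusplus E. l ** t = e_diag I) \<and>
            (\<forall>l\<in>L_plusplus E. l ** t = e_diag I \<longrightarrow>
              cone_automorphism (S_space E) (S_plus E) (Q_map E l) \<and>
              Q_map E l ` F = F_ind E W \<and>
              (\<forall>y\<in>S_plus E. Q_map E l y = l ** y ** transpose l)))))"
proof (intro conjI impI)
  have FS: "F \<subseteq> S_plus E"
    using face by (simp add: cone_face_def)
  have "convex F" "F \<noteq> {}"
    using face by (auto simp: cone_face_def convex_cone_def)
  then obtain x where x: "x \<in> rel_interior F"
    using rel_interior_eq_empty by blast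
  have xS: "x \<in> S_plus E"
    using x FS rel_interior_subset by blast
  \<comment> \<open>For the first two claims the order comes from inclusion of closed neighbourhoods.\<close>
  {
    obtain le where "forest_order E le"
      using forest_order_exists[OF G] .
    then interpret forest_order E le .
    obtain l I where l: "tri_pos l" "congruence l x = e_diag I"
      using diagonalize[OF xS] .
    note image = face_image[OF face x l]
    show "projectionally_exposed (S_space E) (S_plus E) F"
      by (rule face_projectionally_exposed[OF l(1) image])
    show "\<exists>Q W. cone_automorphism (S_space E) (S_plus E) Q \<and> Q ` F = F_ind E W"
      using cone_automorphism_congruence[OF l(1)] image by blast
  }
  assume tpe: "trivially_perfect_elim_order E"
  interpret forest_order E "\<lambda>i j. i = j \<or> i < j \<and> {i, j} \<in> E"
    using forest_order_tpe[OF _ tpe] G by (simp add: homogeneous_chordal_def)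
  have Lpp: "l \<in> L_plusplus E \<longleftrightarrow> tri_pos l" for l
    unfolding L_plusplus_def tri_pos_def tri_def
    by (auto simp: insert_commute) (metis insert_commute neqE order_less_imp_not_less)+
  have Lp: "tri t \<and> (\<forall>i. 0 \<le> t $ i $ i)" if "t \<in> L_plus E" for t
    using that unfolding L_plus_def tri_def
    by (auto simp: insert_commute) (metis insert_commute neqE order_less_imp_not_less)+
  have Q: "\<forall>y\<in>S_plus E. Q_map E l y = congruence l y" if "tri_pos l" for l
    using that Q_map_eq_congruence by (simp add: tri_pos_def S_space_def span_base)
  have good: "cone_automorphism (S_space E) (S_plus E) (Q_map E l) \<and>
      Q_map E l ` F = F_ind E (UNIV - I) \<and>
      (\<forall>y\<in>S_plus E. Q_map E l y = l ** y ** transpose l)"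
    if "tri_pos l" "x' \<in> rel_interior F" "congruence l x' = e_diag I" for l x' I
  proof -
    have "Q_map E l ` F = congruence l ` F"
      using Q[OF that(1)] FS by (intro image_cong) auto
    then show ?thesis
      using Q_map_automorphism[OF that(1)] face_image[OF face that(2,1,3)] Q[OF that(1)]
      by (simp add: congruence_def)
  qed
  obtain l I where l: "tri_pos l" "congruence l x = e_diag I"
    using diagonalize[OF xS] .
  show "\<exists>W.
        (\<exists>l\<in>L_plusplus E. cone_automorphism (S_space E) (S_plus E) (Q_map E l) \<and>
            Q_map E l ` F = F_ind E W \<and>
            (\<forall>y\<in>S_plus E. Q_map E l y = l ** y ** transpose l)) \<and>
        (\<forall>x t I. x \<in> rel_interior F \<and> t \<in> L_plus E \<and> proper t \<and> x = t ** transpose t \<and>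
            I = {i. t $ i $ i = 0} \<longrightarrow>
            W = UNIV - I \<and>
            (\<exists>l\<in>L_plusplus E. l ** t = e_diag I) \<and>
            (\<forall>l\<in>L_plusplus E. l ** t = e_diag I \<longrightarrow>
              cone_automorphism (S_space E) (S_plus E) (Q_map E l) \<and>
              Q_map E l ` F = F_ind E W \<and>
              (\<forall>y\<in>S_plus E. Q_map E l y = l ** y ** transpose l)))"
  proof (intro exI[of _ "UNIV - I"] conjI allI impI)
    show "\<exists>l\<in>L_plusplus E. cone_automorphism (S_space E) (S_plus E) (Q_map E l) \<and>
        Q_map E l ` F = F_ind E (UNIV - I) \<and>
        (\<forall>y\<in>S_plus E. Q_map E l y = l ** y ** transpose l)"
      using good[OF l(1) x l(2)] l(1) Lpp by blast
  next
    fix x' t J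
    assume *: "x' \<in> rel_interior F \<and> t \<in> L_plus E \<and> proper t \<and> x' = t ** transpose t \<and>
      J = {i. t $ i $ i = 0}"
    then have t: "tri t" "\<And>i. 0 \<le> t $ i $ i" "proper t" and J: "J = {i. t $ i $ i = 0}"
      using Lp by auto
    obtain k where k: "tri_pos k" "k ** t = e_diag J"
      unfolding J by (rule proper_left_inverse[OF t])
    have diag: "congruence a x' = e_diag J" if "a ** t = e_diag J" for a
    proof -
      have "congruence a x' = (a ** t) ** transpose (a ** t)"
        using * by (simp add: congruence_def matrix_transpose_mul matrix_mul_assoc)
      also have "\<dots> = congruence (e_diag J) (mat 1)"
        by (simp add: that congruence_def)
      also have "\<dots> = e_diag J"
        unfolding vec_eq_iff congruence_e_diag by (simp add: e_diag_def mat_def)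
      finally show ?thesis .
    qed
    have image: "congruence k ` F = F_ind E (UNIV - J)"
      using face_image[OF face _ k(1) diag[OF k(2)]] * by blast
    note image' = face_image[OF face x l]
    show W: "UNIV - I = UNIV - J"
      by (rule subset_antisym)
        (rule vertex_set_mono[OF l(1) image' k(1) image],
          rule vertex_set_mono[OF k(1) image l(1) image'])
    show "\<exists>l\<in>L_plusplus E. l ** t = e_diag J"
      using k Lpp by blast
    show "\<forall>l\<in>L_plusplus E. l ** t = e_diag J \<longrightarrow>
        cone_automorphism (S_space E) (S_plus E) (Q_map E l) \<and>
        Q_map E l ` F = F_ind E (UNIV - I) \<and>
        (\<forall>y\<in>S_plus E. Q_map E l y = l ** y ** transpose l)"
      unfolding W
    proof (intro ballI impI)
      fix a assume "a \<in> L_plusplus E" "a ** t = e_diag J"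
      then show "cone_automorphism (S_space E) (S_plus E) (Q_map E a) \<and>
          Q_map E a ` F = F_ind E (UNIV - J) \<and>
          (\<forall>y\<in>S_plus E. Q_map E a y = a ** y ** transpose a)"
        using good[OF _ conjunct1[OF *] diag] Lpp by blast
    qed
  qed
qed

end
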